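(* Let $q$ be of the form $$q(\theta)=\int_0^\infty f(y)\exp(-y\theta)\,dy$$ for a given integrable function $f$, and let $\mathcal{C}=\{\theta\in\mathbb{R}:|q(\theta)|<\infty\}$. For $X$ with density $h(x)\exp\{x\theta-\mathcal{A}(\theta)\}$ with respect to Lebesgue measure on $(-\infty,a)$, there exists for $\theta\in\mathcal{C}$ a unique unbiased estimator of $q(\theta)$, and it is given by $$\delta_0(X)=\frac{1}{h(X)}\int_X^a h(s)\,f(s-X)\,ds .$$
   Context: The statistic $X\in\mathbb{R}$ has the one-parameter exponential family density $h(x)\exp\{x\theta-\mathcal{A}(\theta)\}$ with respect to Lebesgue measure on $(-\infty,a)$, where $a$ is either finite or $+\infty$, and $\theta$ ranges over the natural parameter space $\Theta=\{\theta\in\mathbb{R}:\int_{-\infty}^a h(x)\exp(x\theta)\,dx<\infty\}$. Here $\mathcal{A}(\theta)$ is the normalizing term, so that the density integrates to one. It is assumed that $\Theta$ contains an interval of the form $(0,\zeta)$. An estimator $\delta(X)$ is unbiased for $q(\theta)$ for $\theta\in\mathcal{C}$ when $\mathbb{E}_\theta\{\delta(X)\}=q(\theta)$ for all $\theta\in\mathcal{C}$ (with $\theta\in\Theta$, so that the density is defined), where $\mathbb{E}_\theta$ is expectation under the density with parameter $\theta$. Uniqueness is among functions of $X$, in the usual almost-sure sense. The word "integrable" for $f$ is not meant to force $\int_0^\infty|f(y)|\,dy<\infty$: the intended cases include $f(y)=1$, giving $q(\theta)=\frac1\theta$ with $\mathcal{C}=(0,\infty)$, and $f(y)=\frac{1}{\Gamma(k)}y^{k-1}e^{-by}$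 with $k>0$, giving $q(\theta)=(b+\theta)^{-k}$ with $\mathcal{C}=(-b,\infty)$.
   Formalization: It is assumed that h is positive almost everywhere on (-∞,a), and uniqueness is claimed only when the intersection of C with the natural parameter space Θ has nonempty interior; without these the claim is false. *)

theory Defs
  imports "HOL-Analysis.Analysis"
begin

definition lborel_below :: "ereal \<Rightarrow> real measure" where
  "lborel_below a = restrict_space lborel {x. ereal x < a}"

definition natural_params :: "(real \<Rightarrow> real) \<Rightarrow> ereal \<Rightarrow> real set" where
  "natural_params h a = {\<theta>. (\<integral>\<^sup>+ x. ennreal (h x * exp (x * \<theta>)) \<partial>lborel_below a) < \<infinity>}"

definition log_normalizer :: "(real \<Rightarrow> real) \<Rightarrow> ereal \<Rightarrow> real \<Rightarrow> real" where
  "log_normalizer h a \<theta> = ln (\<integral> x. h x * exp (x * \<theta>) \<partial>lborel_below a)"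

definition exp_family :: "(real \<Rightarrow> real) \<Rightarrow> ereal \<Rightarrow> real \<Rightarrow> real measure" where
  "exp_family h a \<theta> =
     density (lborel_below a) (\<lambda>x. ennreal (h x * exp (x * \<theta> - log_normalizer h a \<theta>)))"

text \<open>
  The Lebesgue integral of \<open>f(y) exp(-y\<theta>)\<close> over \<open>(0,\<infinity>)\<close> as an extended real: the integral of
  the positive part minus that of the negative part. An undefined integral
  (\<open>\<infinity> - \<infinity>\<close>, which is \<open>\<infinity>\<close> in type ereal) does not count as finite, so the value is finite
  exactly when the integrand is Lebesgue integrable.
\<close>

definition laplace :: "(real \<Rightarrow> real) \<Rightarrow> real \<Rightarrow> ereal" where
  "laplace f \<theta> =
     enn2ereal (\<integral>\<^sup>+ y. ennreal (f y * exp (- y * \<theta>)) \<partial>restrict_space lborel {0<..})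
   - enn2ereal (\<integral>\<^sup>+ y. ennreal (- (f y * exp (- y * \<theta>))) \<partial>restrict_space lborel {0<..})"

definition finite_set_of :: "(real \<Rightarrow> ereal) \<Rightarrow> real set" where
  "finite_set_of q = {\<theta>. \<bar>q \<theta>\<bar> < \<infinity>}"

text \<open>
  Unbiasedness includes existence of the expectation, and is required only at parameters for
  which the density is defined.
\<close>

definition unbiased_for ::
    "(real \<Rightarrow> real) \<Rightarrow> ereal \<Rightarrow> (real \<Rightarrow> ereal) \<Rightarrow> real set \<Rightarrow> (real \<Rightarrow> real) \<Rightarrow> bool" where
  "unbiased_for h a q C \<delta> \<longleftrightarrow>
     \<delta> \<in> borel_measurable (lborel_below a) \<and>
     (\<forall>\<theta> \<in> C \<inter> natural_params h a.
        integrable (exp_family h a \<theta>) \<delta> \<and> ereal (\<integral> x. \<delta> x \<partial>exp_family h a \<theta>) = q \<theta>)"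

definition delta0 :: "(real \<Rightarrow> real) \<Rightarrow> ereal \<Rightarrow> (real \<Rightarrow> real) \<Rightarrow> real \<Rightarrow> real" where
  "delta0 h a f x = 1 / h x * (LINT s:{s. x < s \<and> ereal s < a}|lborel. h s * f (s - x))"

end

(* Multiplying delta0 by h(x) exp(x theta) and integrating over x gives, by Fubini, the product of
   the Laplace transform of f with the integral of h(s) exp(s theta), which is unbiasedness. For
   uniqueness, let d be the difference of two unbiased estimators. The two-sided Laplace transform of
   h d vanishes on a real interval, hence, being holomorphic, on the vertical strip over it. On a
   vertical line inside the strip it is a Fourier transform, so h d = 0 almost everywhere by Levy's
   uniqueness theorem applied to the normalized positive and negative parts. *)
theory Submission
  imports Defs "HOL-Probability.Levy" "HOL-Complex_Analysis.Conformal_Mappings"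
begin

section \<open>Holomorphy of the two-sided Laplace transform\<close>

text \<open>Expanding \<open>exp (z * of_real x)\<close> about a point of the strip and integrating
  term by term gives a convergent power series. The exchange is justified by two real exponential
  weights, whose exponents stay between \<open>u\<close> and \<open>v\<close>.\<close>

lemma holomorphic_two_sided_laplace:
  fixes g :: "real \<Rightarrow> real" and u v :: real
  assumes int: "\<And>t. u < t \<Longrightarrow> t < v \<Longrightarrow> integrable lborel (\<lambda>x. g x * exp (t * x))"
  shows "(\<lambda>z. \<integral>x. complex_of_real (g x) * exp (z * of_real x) \<partial>lborel)
    holomorphic_on {z. u < Re z \<and> Re z < v}" (is "?F holomorphic_on ?S")
proof -
  have "?S = {z. u < Re z} \<inter> {z. Re z < v}" by auto
  then have "open ?S" by (simp add: open_halfspace_Re_lt open_halfspace_Re_gt open_Int)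
  moreover have "\<exists>r>0. ?F holomorphic_on ball z0 r" if z0: "z0 \<in> ?S" for z0
  proof -
    \<comment> \<open>The distance from \<open>z0\<close> to the boundary of the strip: for \<rho> <
      \<open>r\<close> both \<open>Re z0 - \<rho>\<close> and \<open>Re z0 + \<rho>\<close> remain
      strictly between \<open>u\<close> and \<open>v\<close>.\<close>
    define r where "r = min (Re z0 - u) (v - Re z0)"
    have "r > 0" using z0 by (simp add: r_def)
    have "integrable lborel (\<lambda>x. g x * exp (Re z0 * x))" using int z0 by simp
    then have "(\<lambda>x. g x * exp (Re z0 * x)) \<in> borel_measurable lborel" by (rule borel_measurable_integrable)
    \<comment> \<open>Integrability only speaks of the weighted function; multiplying by the inverse
      weight recovers measurability of \<open>g\<close> itself.\<close>
    then have "(\<lambda>x. g x * exp (Re z0 * x) * exp (- Re z0 * x)) \<in> borel_measurable lborel"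
      by (rule borel_measurable_times) simp
    then have g[measurable]: "g \<in> borel_measurable lborel"
      by (simp add: mult.assoc flip: exp_add)
    define a where
      "a n = (\<integral>x. complex_of_real (g x) * exp (z0 * of_real x) * of_real x ^ n / fact n \<partial>lborel)" for n
    have "(\<lambda>n. a n * (w - z0) ^ n) sums ?F w" if w: "w \<in> ball z0 r" for w
    proof -
      define \<rho> where "\<rho> = norm (w - z0)"
      have \<rho>: "0 \<le> \<rho>" "\<rho> < r"
        using w by (auto simp: \<rho>_def dist_norm norm_minus_commute)
      define f where
        "f n x = complex_of_real (g x) * exp (z0 * of_real x) * of_real x ^ n / fact n * (w - z0) ^ n" for n x
      have [measurable]: "f n \<in> borel_measurable lborel" for n
        unfolding f_def by measurable
      \<comment> \<open>The absolute series sums to \<open>\<bar>g x\<bar> * exp (Re z0 * x) * exp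
        (\<rho> * \<bar>x\<bar>)\<close>. Replacing \<open>exp (\<rho> * \<bar>x\<bar>)\<close> by
        \<open>exp (- \<rho> * x) + exp (\<rho> * x)\<close> gives an integrable majorant of all
        partial sums.\<close>
      define D where "D x = \<bar>g x\<bar> * (exp ((Re z0 - \<rho>) * x) + exp ((Re z0 + \<rho>) * x))" for x
      have D_int: "integrable lborel D"
      proof -
        have "integrable lborel (\<lambda>x. norm (g x * exp ((Re z0 - \<rho>) * x)))"
             "integrable lborel (\<lambda>x. norm (g x * exp ((Re z0 + \<rho>) * x)))"
          using \<rho> by (intro integrable_norm int; simp add: r_def)+
        then have "integrable lborel (\<lambda>x. norm (g x * exp ((Re z0 - \<rho>) * x))
            + norm (g x * exp ((Re z0 + \<rho>) * x)))"
          by (rule Bochner_Integration.integrable_add)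
        then show ?thesis by (simp add: D_def[abs_def] abs_mult distrib_left)
      qed
      have norm_f: "norm (f n x) = \<bar>g x\<bar> * exp (Re z0 * x) * ((\<rho> * \<bar>x\<bar>) ^ n / fact n)" for n x
        by (simp add: f_def norm_mult norm_divide norm_power \<rho>_def power_mult_distrib)
      have sums_norm: "(\<lambda>n. norm (f n x)) sums (\<bar>g x\<bar> * exp (Re z0 * x) * exp (\<rho> * \<bar>x\<bar>))" for x
        unfolding norm_f using exp_converges[of "\<rho> * \<bar>x\<bar>"]
        by (intro sums_mult) (simp add: divide_inverse mult.commute)
      have le_D: "\<bar>g x\<bar> * exp (Re z0 * x) * exp (\<rho> * \<bar>x\<bar>) \<le> D x" for x
      proof -
        have "exp (Re z0 * x) * exp (\<rho> * \<bar>x\<bar>) \<le> exp ((Re z0 - \<rho>) * x) + exp ((Re z0 + \<rho>) * x)"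
          by (cases "x \<ge> 0") (auto simp: algebra_simps simp flip: exp_add)
        then show ?thesis unfolding D_def by (simp add: mult.assoc mult_left_mono)
      qed
      have sum_le_D: "(\<Sum>i<n. norm (f i x)) \<le> D x" for n x
      proof -
        have "(\<Sum>i<n. norm (f i x)) \<le> (\<Sum>i. norm (f i x))"
          using sums_norm by (intro sum_le_suminf) (auto simp: sums_iff)
        with le_D[of x] sums_norm[of x] show ?thesis by (simp add: sums_iff)
      qed
      have f_int: "integrable lborel (f n)" for n
      proof (rule Bochner_Integration.integrable_bound[OF D_int])
        show "AE x in lborel. norm (f n x) \<le> norm (D x)"
        proof (intro AE_I2)
          fix x
          have "norm (f n x) \<le> (\<Sum>i<Suc n. norm (f i x))" by (simp add: sum_nonneg)
          with sum_le_D[where x=x and n="Suc n"] show "norm (f n x) \<le> norm (D x)" by simp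
        qed
      qed simp
      have "summable (\<lambda>n. \<integral>x. norm (f n x) \<partial>lborel)"
      proof (rule summableI_nonneg_bounded)
        show "(\<Sum>i<n. \<integral>x. norm (f i x) \<partial>lborel) \<le> (\<integral>x. D x \<partial>lborel)" for n
        proof -
          have "(\<Sum>i<n. \<integral>x. norm (f i x) \<partial>lborel) = (\<integral>x. (\<Sum>i<n. norm (f i x)) \<partial>lborel)"
            using f_int by (simp add: Bochner_Integration.integral_sum)
          also have "\<dots> \<le> (\<integral>x. D x \<partial>lborel)"
            using f_int D_int sum_le_D by (intro integral_mono) auto
          finally show ?thesis .
        qed
      qed simp
      moreover have "AE x in lborel. summable (\<lambda>n. norm (f n x))"
        using sums_norm by (auto simp: sums_iff)
      ultimately have "(\<lambda>n. integral\<^sup>L lborel (f n)) sums (\<integral>x. (\<Sum>n. f n x) \<partial>lborel)"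
        using f_int by (intro sums_integral) auto
      moreover have "integral\<^sup>L lborel (f n) = a n * (w - z0) ^ n" for n
        unfolding f_def a_def by (rule integral_mult_left_zero)
      \<comment> \<open>The series in \<open>n\<close> is the exponential series of
        \<open>x * (w - z0)\<close>, which shifts the exponent from \<open>z0\<close> to
        \<open>w\<close>.\<close>
      moreover have "(\<Sum>n. f n x) = complex_of_real (g x) * exp (w * of_real x)" for x
      proof -
        have "(\<lambda>n. complex_of_real (g x) * exp (z0 * of_real x) *
            ((of_real x * (w - z0)) ^ n /\<^sub>R fact n)) sums
          (complex_of_real (g x) * exp (z0 * of_real x) * exp (of_real x * (w - z0)))"
          by (intro sums_mult exp_converges)
        also have "(\<lambda>n. complex_of_real (g x) * exp (z0 * of_real x) *
            ((of_real x * (w - z0)) ^ n /\<^sub>R fact n)) = (\<lambda>n. f n x)"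
          by (simp add: f_def fun_eq_iff power_mult_distrib scaleR_conv_of_real divide_inverse)
        also have "complex_of_real (g x) * exp (z0 * of_real x) * exp (of_real x * (w - z0)) =
            complex_of_real (g x) * exp (w * of_real x)"
          by (simp add: mult.assoc algebra_simps flip: exp_add)
        finally show ?thesis by (simp add: sums_iff)
      qed
      ultimately show ?thesis by simp
    qed
    then have "?F holomorphic_on ball z0 r" by (rule power_series_holomorphic)
    with \<open>r > 0\<close> show ?thesis by blast
  qed
  ultimately show ?thesis
    by (meson analytic_imp_holomorphic analytic_on_def)
qed

section \<open>Injectivity of the Fourier and two-sided Laplace transforms\<close>

lemma real_distribution_density:
  fixes p :: "real \<Rightarrow> real"
  assumes p: "integrable lborel p" "\<And>x. 0 \<le> p x" "(\<integral>x. p x \<partial>lborel) = 1"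
  shows "real_distribution (density lborel (\<lambda>x. ennreal (p x)))"
proof -
  have [measurable]: "p \<in> borel_measurable lborel" using p by auto
  have "prob_space (density lborel (\<lambda>x. ennreal (p x)))"
    by (rule prob_spaceI) (use p in \<open>simp add: emeasure_density nn_integral_eq_integral\<close>)
  then show ?thesis
    by (simp add: real_distribution_def real_distribution_axioms_def)
qed

lemma AE_zero_if_fourier_zero:
  fixes g :: "real \<Rightarrow> real"
  assumes g: "integrable lborel g"
    and zero: "\<And>t. (\<integral>x. complex_of_real (g x) * iexp (t * x) \<partial>lborel) = 0"
  shows "AE x in lborel. g x = 0"
proof -
  define P N where "P x = max 0 (g x)" and "N x = max 0 (- g x)" for x
  have P: "integrable lborel P" and N: "integrable lborel N"
    unfolding P_def[abs_def] N_def[abs_def] using g by auto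
  have [measurable]: "P \<in> borel_measurable lborel" "N \<in> borel_measurable lborel"
    using P N by auto
  have g_eq: "g x = P x - N x" for x by (simp add: P_def N_def)
  have nonneg: "0 \<le> P x" "0 \<le> N x" for x by (auto simp: P_def N_def)
  have fourier_int: "integrable lborel (\<lambda>x. complex_of_real (p x) * iexp (t * x))"
    if "integrable lborel p" for p t
    using that by (rule Bochner_Integration.integrable_bound) (use that in \<open>auto simp: norm_mult\<close>)
  have fourier_eq: "(\<integral>x. complex_of_real (P x) * iexp (t * x) \<partial>lborel) =
      (\<integral>x. complex_of_real (N x) * iexp (t * x) \<partial>lborel)" for t
    using zero[of t] fourier_int[OF P, of t] fourier_int[OF N, of t]
    by (simp add: g_eq left_diff_distrib)
  define c where "c = (\<integral>x. P x \<partial>lborel)"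
  \<comment> \<open>Frequency zero gives the total masses, so one constant \<open>c\<close>
    normalizes both parts to probability densities.\<close>
  have c_N: "c = (\<integral>x. N x \<partial>lborel)"
    using fourier_eq[of 0] by (simp add: c_def)
  have "c \<ge> 0" unfolding c_def using nonneg by simp
  show ?thesis
  \<comment> \<open>Mass zero cannot be normalized, but then both nonnegative parts already vanish
    almost everywhere.\<close>
  proof (cases "c = 0")
    case True
    then have "AE x in lborel. P x = 0" "AE x in lborel. N x = 0"
      using integral_nonneg_eq_0_iff_AE[OF P] integral_nonneg_eq_0_iff_AE[OF N] nonneg c_def c_N
      by auto
    then show ?thesis by eventually_elim (simp add: g_eq)
  next
    case False
    with \<open>c \<ge> 0\<close> have "c > 0" by simp
    let ?M = "\<lambda>p. density lborel (\<lambda>x. ennreal (p x / c))"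
    have char: "char (?M p) t = (\<integral>x. complex_of_real (p x) * iexp (t * x) \<partial>lborel) / c"
      if "integrable lborel p" "\<And>x. 0 \<le> p x" for p t
    proof -
      have [measurable]: "p \<in> borel_measurable lborel" using that by auto
      have "char (?M p) t = (\<integral>x. (p x / c) *\<^sub>R iexp (t * x) \<partial>lborel)"
        unfolding char_def using that \<open>c > 0\<close> by (subst integral_density) auto
      also have "\<dots> = (\<integral>x. complex_of_real (p x) * iexp (t * x) / c \<partial>lborel)"
        by (simp add: scaleR_conv_of_real)
      finally show ?thesis by simp
    qed
    have "?M P = ?M N"
    proof (rule Levy_uniqueness)
      show "real_distribution (?M P)" "real_distribution (?M N)"
        by (rule real_distribution_density; use P N nonneg \<open>c > 0\<close> c_def c_N in simp)+
      show "char (?M P) = char (?M N)"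
        using P N nonneg fourier_eq by (auto simp: char fun_eq_iff)
    qed
    \<comment> \<open>Equal measures have almost everywhere equal densities; nonnegativity then lets
      the coercion to \<open>ennreal\<close> be removed.\<close>
    then have "AE x in lborel. ennreal (P x / c) = ennreal (N x / c)"
      by (intro sigma_finite_measure.density_unique[OF sigma_finite_lborel]) auto
    then show ?thesis
      by eventually_elim (use \<open>c > 0\<close> nonneg in \<open>auto simp: g_eq\<close>)
  qed
qed

lemma AE_zero_if_two_sided_laplace_zero:
  fixes g :: "real \<Rightarrow> real" and u v :: real
  assumes "u < v"
    and int: "\<And>t. u < t \<Longrightarrow> t < v \<Longrightarrow> integrable lborel (\<lambda>x. g x * exp (t * x))"
    and zero: "\<And>t. u < t \<Longrightarrow> t < v \<Longrightarrow> (\<integral>x. g x * exp (t * x) \<partial>lborel) = 0"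
  shows "AE x in lborel. g x = 0"
proof -
  define F where "F z = (\<integral>x. complex_of_real (g x) * exp (z * of_real x) \<partial>lborel)" for z
  define S where "S = {z. u < Re z \<and> Re z < v}"
  \<comment> \<open>The midpoint serves twice: as the accumulation point of zeros for the identity
    theorem, and as the real part of the vertical line on which \<open>F\<close> is read as a
    Fourier transform.\<close>
  define c where "c = (u + v) / 2"
  have c: "u < c" "c < v" using \<open>u < v\<close> by (auto simp: c_def)
  have S_eq: "S = {z. u < Re z} \<inter> {z. Re z < v}" by (auto simp: S_def)
  have "F holomorphic_on S"
    unfolding F_def S_def by (rule holomorphic_two_sided_laplace) (rule int)
  moreover have "open S"
    by (simp add: S_eq open_halfspace_Re_lt open_halfspace_Re_gt open_Int)
  moreover have "connected S"
    unfolding S_eq by (intro convex_connected convex_Int convex_halfspace_Re_gt convex_halfspace_Re_lt)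
  moreover have "complex_of_real ` {u<..<v} \<subseteq> S" by (auto simp: S_def)
  moreover have "complex_of_real c \<in> S" using c by (simp add: S_def)
  moreover have "complex_of_real c islimpt complex_of_real ` {u<..<v}"
  proof -
    have "c islimpt {u<..<v}" using c by (intro interior_limit_point) simp
    then show ?thesis
      by (auto simp: islimpt_approachable dist_of_real)
  qed
  moreover have "F z = 0" if z: "z \<in> complex_of_real ` {u<..<v}" for z
  proof -
    obtain t where t: "z = complex_of_real t" "u < t" "t < v"
      using z by auto
    have "F z = (\<integral>x. complex_of_real (g x * exp (t * x)) \<partial>lborel)"
      by (simp add: F_def t exp_of_real flip: of_real_mult)
    also have "\<dots> = 0" using zero t by (simp only: integral_complex_of_real) simp
    finally show ?thesis .
  qed
  ultimately have F_zero: "F z = 0" if "z \<in> S" for z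
    using analytic_continuation[of F S "complex_of_real ` {u<..<v}" "complex_of_real c" z] that
    by blast
  have "AE x in lborel. g x * exp (c * x) = 0"
  proof (rule AE_zero_if_fourier_zero)
    show "integrable lborel (\<lambda>x. g x * exp (c * x))" using c by (rule int)
    show "(\<integral>x. complex_of_real (g x * exp (c * x)) * iexp (t * x) \<partial>lborel) = 0" for t
    proof -
      have "F (Complex c t) = 0" using c by (intro F_zero) (simp add: S_def)
      moreover have "complex_of_real (g x) * exp (Complex c t * of_real x) =
          complex_of_real (g x * exp (c * x)) * iexp (t * x)" for x
        by (simp add: Complex_eq distrib_right mult.assoc exp_of_real exp_add flip: of_real_mult)
      ultimately show ?thesis by (simp add: F_def)
    qed
  qed
  then show ?thesis by simp
qed

section \<open>Correlation integrals and the one-sided Laplace transform\<close>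

text \<open>The reflection y = s - x makes the inner integral over x independent of s, so the double
  integral factors, also with absolute values; this is what licenses Fubini. With exponentially
  weighted \<open>p\<close> and \<open>q\<close> it is the computation behind unbiasedness.\<close>

lemma fixes p q :: "real \<Rightarrow> real"
  assumes p: "integrable lborel p" and q: "integrable lborel q"
  shows integrable_correlation: "integrable lborel (\<lambda>x. \<integral>s. p s * q (s - x) \<partial>lborel)"
    and integral_correlation:
      "(\<integral>x. (\<integral>s. p s * q (s - x) \<partial>lborel) \<partial>lborel) = (\<integral>s. p s \<partial>lborel) * (\<integral>y. q y \<partial>lborel)"
proof -
  have [measurable]: "p \<in> borel_measurable borel" "q \<in> borel_measurable borel"
    using borel_measurable_integrable[OF p] borel_measurable_integrable[OF q] by simp_all
  have q_int: "integrable lborel (\<lambda>x. q (s - x))" for s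
    using lborel_integrable_real_affine[OF q, of "-1" s] by simp
  have q_eq: "(\<integral>x. q (s - x) \<partial>lborel) = (\<integral>y. q y \<partial>lborel)" for s
    using lborel_integral_real_affine[of "-1" q s] by simp
  have q_abs_eq: "(\<integral>x. \<bar>q (s - x)\<bar> \<partial>lborel) = (\<integral>y. \<bar>q y\<bar> \<partial>lborel)" for s
    using lborel_integral_real_affine[of "-1" "\<lambda>y. \<bar>q y\<bar>" s] by simp
  have K: "integrable (lborel \<Otimes>\<^sub>M lborel) (\<lambda>(s, x). p s * q (s - x))"
  proof (rule lborel_pair.Fubini_integrable)
    show "integrable lborel (\<lambda>s. \<integral>x. norm (case (s, x) of (s, x) \<Rightarrow> p s * q (s - x)) \<partial>lborel)"
      using p by (simp add: abs_mult q_abs_eq)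
    show "AE s in lborel. integrable lborel (\<lambda>x. case (s, x) of (s, x) \<Rightarrow> p s * q (s - x))"
      using q_int by simp
  qed measurable
  show "integrable lborel (\<lambda>x. \<integral>s. p s * q (s - x) \<partial>lborel)"
    by (rule lborel_pair.integrable_snd[OF K])
  have "(\<integral>x. (\<integral>s. p s * q (s - x) \<partial>lborel) \<partial>lborel) = (\<integral>s. (\<integral>x. p s * q (s - x) \<partial>lborel) \<partial>lborel)"
    by (rule lborel_pair.Fubini_integral[OF K])
  then show "(\<integral>x. (\<integral>s. p s * q (s - x) \<partial>lborel) \<partial>lborel) = (\<integral>s. p s \<partial>lborel) * (\<integral>y. q y \<partial>lborel)"
    by (simp add: q_eq)
qed

lemma
  assumes f: "f \<in> borel_measurable (restrict_space lborel {0<..})"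
    and \<theta>: "\<theta> \<in> finite_set_of (laplace f)"
  shows integrable_laplace: "integrable (restrict_space lborel {0<..}) (\<lambda>y. f y * exp (- y * \<theta>))"
    and laplace_eq_integral:
      "laplace f \<theta> = ereal (\<integral>y. f y * exp (- y * \<theta>) \<partial>restrict_space lborel {0<..})"
proof -
  let ?R = "restrict_space lborel {0::real<..}" and ?g = "\<lambda>y. f y * exp (- y * \<theta>)"
  let ?P = "\<integral>\<^sup>+ y. ennreal (?g y) \<partial>?R" and ?N = "\<integral>\<^sup>+ y. ennreal (- ?g y) \<partial>?R"
  have "(\<lambda>y. exp (- y * \<theta>)) \<in> borel_measurable ?R"
    by (intro measurable_restrict_space1) simp
  with f have [measurable]: "?g \<in> borel_measurable ?R"
    by (rule borel_measurable_times)
  have "\<bar>enn2ereal ?P - enn2ereal ?N\<bar> \<noteq> \<infinity>"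
    using \<theta> by (simp add: finite_set_of_def laplace_def)
  moreover have "0 \<le> enn2ereal ?P" "0 \<le> enn2ereal ?N" by simp_all
  \<comment> \<open>An infinite part would make the difference infinite too, since \<infinity> -
    \<infinity> is \<infinity> in \<open>ereal\<close>.\<close>
  ultimately have fin: "?P \<noteq> \<infinity>" "?N \<noteq> \<infinity>"
    by (cases "enn2ereal ?P"; cases "enn2ereal ?N"; fastforce)+
  show "integrable ?R ?g"
    unfolding real_integrable_def using fin by (intro conjI) measurable
  then have "integral\<^sup>L ?R ?g = enn2real ?P - enn2real ?N"
    by (rule real_lebesgue_integral_def)
  moreover have "enn2ereal x = ereal (enn2real x)" if "x \<noteq> \<infinity>" for x
    using that by (cases x) auto
  ultimately show "laplace f \<theta> = ereal (integral\<^sup>L ?R ?g)"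
    using fin by (simp add: laplace_def)
qed

section \<open>Exponential families with almost everywhere positive \<open>h\<close>\<close>

text \<open>Excluding -\<infinity> keeps the half-line below \<open>a\<close> nonempty, hence of
  positive measure. Positivity of \<open>h\<close> makes division by \<open>h\<close> meaningful up
  to a null set.\<close>

locale positive_exp_family =
  fixes h :: "real \<Rightarrow> real" and a :: ereal
  assumes a: "a \<noteq> -\<infinity>"
    and h: "h \<in> borel_measurable (lborel_below a)"
    and h_pos: "AE x in lborel_below a. 0 < h x"
begin

text \<open>Extending \<open>h\<close> by zero turns all integrals below \<open>a\<close> into
  integrals over the whole line, where the transform and correlation lemmas apply.\<close>

definition H :: "real \<Rightarrow> real" where
  "H x = indicator {x. ereal x < a} x * h x"

lemma sets_below [measurable]: "{x. ereal x < a} \<in> sets borel"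
  by measurable

lemma measurable_below_iff:
  fixes d :: "real \<Rightarrow> real"
  shows "d \<in> borel_measurable (lborel_below a) \<longleftrightarrow>
    (\<lambda>x. indicator {x. ereal x < a} x * d x) \<in> borel_measurable borel"
  unfolding lborel_below_def by (subst borel_measurable_restrict_space_iff) auto

lemma H_measurable [measurable]: "H \<in> borel_measurable borel"
  using h unfolding measurable_below_iff H_def[abs_def] .

lemma AE_below_iff:
  "(AE x in lborel_below a. P x) \<longleftrightarrow> (AE x in lborel. ereal x < a \<longrightarrow> P x)"
  unfolding lborel_below_def by (subst AE_restrict_space_iff) auto

lemma AE_H_pos: "AE x in lborel. ereal x < a \<longrightarrow> 0 < H x"
  using h_pos unfolding AE_below_iff by eventually_elim (simp add: H_def)

lemma weight_measurable: "(\<lambda>x. exp (x * \<theta> - c)) \<in> borel_measurable (lborel_below a)"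
  unfolding lborel_below_def by (intro measurable_restrict_space1) simp

text \<open>Translates expectations into two-sided Laplace integrals. The normalizing factor is
  constant in x and nonzero, so it leaves integrability unchanged and pulls out of the
  integral.\<close>

lemma
  fixes d :: "real \<Rightarrow> real"
  assumes d: "d \<in> borel_measurable (lborel_below a)"
  shows integrable_exp_family_iff: "integrable (exp_family h a \<theta>) d \<longleftrightarrow>
      integrable lborel (\<lambda>x. H x * d x * exp (\<theta> * x))"
    and integral_exp_family: "(\<integral>x. d x \<partial>exp_family h a \<theta>) =
      exp (- log_normalizer h a \<theta>) * (\<integral>x. H x * d x * exp (\<theta> * x) \<partial>lborel)"
proof -
  let ?L = "log_normalizer h a \<theta>" and ?w = "\<lambda>x. h x * exp (x * \<theta> - log_normalizer h a \<theta>)"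
  have w: "?w \<in> borel_measurable (lborel_below a)"
    by (intro borel_measurable_times h weight_measurable)
  have nonneg: "AE x in lborel_below a. 0 \<le> ?w x"
    using h_pos by eventually_elim simp
  have eq: "indicator {x. ereal x < a} x *\<^sub>R (?w x *\<^sub>R d x) = exp (- ?L) * (H x * d x * exp (\<theta> * x))" for x
    by (simp add: H_def exp_diff exp_minus field_simps)
  show "integrable (exp_family h a \<theta>) d \<longleftrightarrow> integrable lborel (\<lambda>x. H x * d x * exp (\<theta> * x))"
    unfolding exp_family_def integrable_density[OF d w nonneg]
    unfolding lborel_below_def
    by (subst integrable_restrict_space) (simp_all only: eq, simp_all)
  show "(\<integral>x. d x \<partial>exp_family h a \<theta>) = exp (- ?L) * (\<integral>x. H x * d x * exp (\<theta> * x) \<partial>lborel)"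
    unfolding exp_family_def integral_density[OF d w nonneg]
    unfolding lborel_below_def
    by (subst integral_restrict_space) (simp_all only: eq, simp_all)
qed

lemma AE_exp_family: "AE x in exp_family h a \<theta>. P x" if "AE x in lborel_below a. P x"
  unfolding exp_family_def
  using that
  by (subst AE_density)
    (auto intro!: measurable_compose[OF _ measurable_ennreal] borel_measurable_times h weight_measurable)

text \<open>The exponential undoes \<open>ln\<close> only at a positive argument, so the work lies
  in showing that the normalizing integral is not zero.\<close>

lemma
  assumes \<theta>: "\<theta> \<in> natural_params h a"
  shows integrable_H: "integrable lborel (\<lambda>x. H x * exp (\<theta> * x))"
    and exp_log_normalizer: "exp (log_normalizer h a \<theta>) = (\<integral>x. H x * exp (\<theta> * x) \<partial>lborel)"
proof -
  let ?g = "\<lambda>x. h x * exp (x * \<theta>)"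
  have eq: "indicator {x. ereal x < a} x *\<^sub>R ?g x = H x * exp (\<theta> * x)" for x
    by (simp add: H_def mult.commute)
  have "?g \<in> borel_measurable (lborel_below a)"
    using weight_measurable[of \<theta> 0] by (intro borel_measurable_times h) simp
  moreover have "AE x in lborel_below a. 0 \<le> ?g x"
    using h_pos by eventually_elim simp
  ultimately have "integrable (lborel_below a) ?g"
    using \<theta> by (intro integrableI_nonneg) (simp_all add: natural_params_def)
  then show int: "integrable lborel (\<lambda>x. H x * exp (\<theta> * x))"
    unfolding lborel_below_def by (subst (asm) integrable_restrict_space) (simp_all only: eq, simp_all)
  have L: "log_normalizer h a \<theta> = ln (\<integral>x. H x * exp (\<theta> * x) \<partial>lborel)"
    unfolding log_normalizer_def lborel_below_def
    by (subst integral_restrict_space) (simp_all only: eq, simp_all)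
  have nonneg: "AE x in lborel. 0 \<le> H x * exp (\<theta> * x)"
    using AE_H_pos by eventually_elim (auto simp: H_def indicator_def)
  have "(\<integral>x. H x * exp (\<theta> * x) \<partial>lborel) \<noteq> 0"
  proof
    assume "(\<integral>x. H x * exp (\<theta> * x) \<partial>lborel) = 0"
    then have "AE x in lborel. H x * exp (\<theta> * x) = 0"
      using integral_nonneg_eq_0_iff_AE[OF int nonneg] by simp
    with AE_H_pos have "AE x in lborel. x \<notin> {x. ereal x < a}"
      by eventually_elim auto
    \<comment> \<open>A zero integral would make the half-line below \<open>a\<close> null, yet it
      contains the unit interval ending at \<open>b\<close>.\<close>
    moreover obtain b where b: "ereal b < a"
      using a by (metis ereal_dense2 ereal_infty_less(2))
    moreover have "{b - 1<..<b} \<subseteq> {x. ereal x < a}"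
      using b by (auto intro: less_trans[of _ "ereal b"])
    ultimately have "AE x in lborel. x \<notin> {b - 1<..<b}"
      by (elim eventually_mono) blast
    then show False
      by (subst (asm) AE_iff_measurable[of "{b - 1<..<b}"]) auto
  qed
  moreover have "(\<integral>x. H x * exp (\<theta> * x) \<partial>lborel) \<ge> 0"
    using nonneg by (rule integral_nonneg_AE)
  ultimately show "exp (log_normalizer h a \<theta>) = (\<integral>x. H x * exp (\<theta> * x) \<partial>lborel)"
    by (simp add: L)
qed

section \<open>Unbiasedness and uniqueness\<close>

lemma unbiased_delta0:
  assumes f: "f \<in> borel_measurable (restrict_space lborel {0<..})"
  shows "unbiased_for h a (laplace f) (finite_set_of (laplace f)) (delta0 h a f)"
proof -
  \<comment> \<open>Extending \<open>f\<close> by zero encodes the constraint x < s, and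
    \<open>H\<close> encodes s < \<open>a\<close>; the numerator of \<open>delta0\<close> thus
    becomes the correlation \<open>I\<close> over the whole line.\<close>
  define G where "G y = indicator {0<..} y * f y" for y
  have [measurable]: "G \<in> borel_measurable borel"
    using f unfolding G_def[abs_def] by (subst (asm) borel_measurable_restrict_space_iff) auto
  define I where "I x = (\<integral>s. H s * G (s - x) \<partial>lborel)" for x
  have [measurable]: "I \<in> borel_measurable borel"
    unfolding I_def by measurable
  have I_above: "I x = 0" if "\<not> ereal x < a" for x
  proof -
    \<comment> \<open>A nonzero product would need x < s < \<open>a\<close>, contradicting the
      choice of x.\<close>
    have "H s * G (s - x) = 0" for s
      using that less_trans[of "ereal x" "ereal s" a] by (auto simp: H_def G_def indicator_def)
    then show ?thesis unfolding I_def by (simp only: integral_zero)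
  qed
  \<comment> \<open>Outside the support both sides are 0: \<open>I x\<close> vanishes, and division
    by \<open>H x\<close> = 0 yields 0.\<close>
  have delta0_I: "delta0 h a f x = I x / H x" for x
  proof -
    have "delta0 h a f x = 1 / h x * I x"
      unfolding delta0_def I_def set_lebesgue_integral_def
      by (intro arg_cong2[where f="(*)"] Bochner_Integration.integral_cong)
        (auto simp: H_def G_def indicator_def)
    then show ?thesis using I_above[of x] by (cases "ereal x < a") (auto simp: H_def)
  qed
  have [measurable]: "delta0 h a f \<in> borel_measurable borel"
    unfolding delta0_I[abs_def] by measurable
  have meas: "delta0 h a f \<in> borel_measurable (lborel_below a)"
    unfolding lborel_below_def by (intro measurable_restrict_space1) simp
  \<comment> \<open>Below \<open>a\<close>, \<open>H\<close> cancels where it is positive, which is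
    almost everywhere; elsewhere both sides vanish.\<close>
  have AE_eq: "AE x in lborel. H x * delta0 h a f x * exp (\<theta> * x) = I x * exp (\<theta> * x)" for \<theta>
    using AE_H_pos by eventually_elim (auto simp: delta0_I I_above)
  have "integrable (exp_family h a \<theta>) (delta0 h a f) \<and>
      ereal (\<integral>x. delta0 h a f x \<partial>exp_family h a \<theta>) = laplace f \<theta>"
    if C: "\<theta> \<in> finite_set_of (laplace f)" and \<Theta>: "\<theta> \<in> natural_params h a" for \<theta>
  proof -
    have G_eq: "indicator {0<..} y *\<^sub>R (f y * exp (- y * \<theta>)) = G y * exp (- y * \<theta>)" for y
      by (simp add: G_def)
    have q_int: "integrable lborel (\<lambda>y. G y * exp (- y * \<theta>))"
      using integrable_laplace[OF f C]
      by (subst (asm) integrable_restrict_space) (simp_all only: G_eq, simp_all)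
    have q: "laplace f \<theta> = ereal (\<integral>y. G y * exp (- y * \<theta>) \<partial>lborel)"
      unfolding laplace_eq_integral[OF f C]
      by (subst integral_restrict_space) (simp_all only: G_eq, simp_all)
    \<comment> \<open>Splitting \<theta>x as \<theta>s - (s - x)\<theta> distributes the exponential
      over both factors, so each becomes integrable and the correlation lemma applies.\<close>
    have I_eq: "I x * exp (\<theta> * x) = (\<integral>s. (H s * exp (\<theta> * s)) * (G (s - x) * exp (- (s - x) * \<theta>)) \<partial>lborel)" for x
    proof -
      have "(H s * exp (\<theta> * s)) * (G (s - x) * exp (- (s - x) * \<theta>)) = H s * G (s - x) * exp (\<theta> * x)" for s
        by (simp add: algebra_simps flip: exp_add)
      then show ?thesis by (simp only: I_def integral_mult_left_zero)
    qed
    note Hint = integrable_H[OF \<Theta>]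
    have "integrable lborel (\<lambda>x. I x * exp (\<theta> * x))"
      unfolding I_eq by (rule integrable_correlation[OF Hint q_int])
    then have "integrable lborel (\<lambda>x. H x * delta0 h a f x * exp (\<theta> * x))"
      by (subst integrable_cong_AE[OF _ _ AE_eq]) auto
    then have int: "integrable (exp_family h a \<theta>) (delta0 h a f)"
      by (simp only: integrable_exp_family_iff[OF meas])
    have "(\<integral>x. H x * delta0 h a f x * exp (\<theta> * x) \<partial>lborel) = (\<integral>x. I x * exp (\<theta> * x) \<partial>lborel)"
      by (intro integral_cong_AE AE_eq) auto
    also have "\<dots> = (\<integral>x. H x * exp (\<theta> * x) \<partial>lborel) * (\<integral>y. G y * exp (- y * \<theta>) \<partial>lborel)"
      unfolding I_eq by (rule integral_correlation[OF Hint q_int])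
    finally have "(\<integral>x. delta0 h a f x \<partial>exp_family h a \<theta>) = (\<integral>y. G y * exp (- y * \<theta>) \<partial>lborel)"
      \<comment> \<open>The factor
        \<open>\<integral>x. H x * exp (\<theta> * x) \<partial>lborel\<close> is exactly what the
        normalizer divides out.\<close>
      by (simp add: integral_exp_family[OF meas] exp_minus flip: exp_log_normalizer[OF \<Theta>])
    with int q show ?thesis by simp
  qed
  with meas show ?thesis by (auto simp: unbiased_for_def)
qed

text \<open>An interior point supplies the open interval of parameters on which the transform of
  \<open>H x * (\<delta> x - \<delta>' x)\<close> vanishes, as its injectivity requires.\<close>

lemma unbiased_unique:
  assumes C: "interior (C \<inter> natural_params h a) \<noteq> {}"
    and \<delta>: "unbiased_for h a q C \<delta>" and \<delta>': "unbiased_for h a q C \<delta>'"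
  shows "AE x in lborel_below a. \<delta> x = \<delta>' x"
proof -
  obtain c e where "e > 0" and ball: "ball c e \<subseteq> C \<inter> natural_params h a"
    using C unfolding mem_interior ex_in_conv[symmetric] by blast
  have meas: "\<delta> \<in> borel_measurable (lborel_below a)" "\<delta>' \<in> borel_measurable (lborel_below a)"
    using \<delta> \<delta>' by (auto simp: unbiased_for_def)
  have diff: "integrable lborel (\<lambda>x. H x * (\<delta> x - \<delta>' x) * exp (t * x)) \<and>
      (\<integral>x. H x * (\<delta> x - \<delta>' x) * exp (t * x) \<partial>lborel) = 0"
    if "c - e < t" "t < c + e" for t
  proof -
    have "t \<in> C \<inter> natural_params h a" using ball that by (auto simp: dist_real_def)
    then have int: "integrable (exp_family h a t) \<delta>" "integrable (exp_family h a t) \<delta>'"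
      and "ereal (\<integral>x. \<delta> x \<partial>exp_family h a t) = ereal (\<integral>x. \<delta>' x \<partial>exp_family h a t)"
      using \<delta> \<delta>' by (auto simp: unbiased_for_def)
    \<comment> \<open>Both expectations carry the same nonzero normalizing factor, which
      cancels.\<close>
    then have "(\<integral>x. H x * \<delta> x * exp (t * x) \<partial>lborel) = (\<integral>x. H x * \<delta>' x * exp (t * x) \<partial>lborel)"
      by (simp add: integral_exp_family meas)
    then show ?thesis
      using int by (simp add: integrable_exp_family_iff meas right_diff_distrib left_diff_distrib)
  qed
  have "AE x in lborel. H x * (\<delta> x - \<delta>' x) = 0"
    using \<open>e > 0\<close> diff by (intro AE_zero_if_two_sided_laplace_zero[of "c - e" "c + e"]) auto
  with AE_H_pos have "AE x in lborel. ereal x < a \<longrightarrow> \<delta> x = \<delta>' x"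
    by eventually_elim auto
  then show ?thesis by (simp only: AE_below_iff)
qed

end

text \<open>Both parameter sets are convex, so an intersection with empty interior has at most one
  point. Unbiasedness is then at most one linear condition and cannot determine an estimator; hence
  the condition on the interior in the uniqueness part.\<close>

theorem proposition2:
  fixes h f :: "real \<Rightarrow> real" and a :: ereal and \<zeta> :: real
  assumes "a \<noteq> -\<infinity>"
    and "h \<in> borel_measurable (lborel_below a)"
    and "AE x in lborel_below a. 0 < h x"
    and "0 < \<zeta>" and "{0<..<\<zeta>} \<subseteq> natural_params h a"
    and "f \<in> borel_measurable (restrict_space lborel {0<..})"
  shows "unbiased_for h a (laplace f) (finite_set_of (laplace f)) (delta0 h a f) \<and>
    (interior (finite_set_of (laplace f) \<inter> natural_params h a) \<noteq> {} \<longrightarrow>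
      (\<forall>\<delta>. unbiased_for h a (laplace f) (finite_set_of (laplace f)) \<delta> \<longrightarrow>
        (\<forall>\<theta> \<in> natural_params h a. AE x in exp_family h a \<theta>. \<delta> x = delta0 h a f x)))"
proof -
  interpret positive_exp_family h a
    using assms by unfold_locales
  have "unbiased_for h a (laplace f) (finite_set_of (laplace f)) (delta0 h a f)"
    using assms by (intro unbiased_delta0)
  then show ?thesis
    \<comment> \<open>Equality holds Lebesgue-almost everywhere below \<open>a\<close>, hence almost
      surely under every member of the family.\<close>
    by (blast intro: AE_exp_family unbiased_unique)
qed

end
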